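(* Let $Y_1\neq Y_2$ be rays in $V$ and let $F:[Y_1,Y_2]\to[0,\infty]$ be a piecewise monomial function. Fix vectors $\varepsilon_1\in Y_1$, $\varepsilon_2\in Y_2$, let $\pi:[0,\infty]\to[Y_1,Y_2]$, $\pi(\lambda)=\mathrm{ray}(\varepsilon_1+\lambda\varepsilon_2)$ (with $\pi(\infty)=Y_2$), and let $f=F\circ\pi$. (a) The image of $F$ is a closed subinterval $[\rho,\sigma]$ of $[0,\infty]$. If $\alpha_0<\alpha_1<\cdots<\alpha_r$ is a finite sequence in $[0,\infty]$ such that $\pi(\alpha_0)=Y_1$, $\pi(\alpha_r)=Y_2$, and $f$ is monomial on each interval $[\alpha_{s-1},\alpha_s]$, $1\le s\le r$, then $$\rho=\min_{0\le s\le r}f(\alpha_s),\qquad \sigma=\max_{0\le s\le r}f(\alpha_s).$$ (b) If $\varphi$ is a piecewise monomial $[0,\infty]$-valued function on an interval $[u,v]$ in $[0,\infty]$ which contains $[\rho,\sigma]$, then the function $\varphi\circ F:[Y_1,Y_2]\to[0,\infty]$ is again piecewise monomial.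
   Context: $R=\{0\}\cup G$ is a bipotent semifield: $G$ is a nontrivial totally ordered abelian group written multiplicatively with unit $1$, $0$ is absorbing and smaller than all elements of $G$, and addition is $x+y=\max\{x,y\}$. $R$ is assumed root closed: every element of $R$ has an $n$-th root in $R$ for every $n\in\mathbb N$. Write $[0,\infty]=R\cup\{\infty\}$ with $x<\infty$ for all $x\in R$, $0^{-1}=\infty$, $\infty^{-1}=0$, $\gamma\cdot\infty=\infty$ for $\gamma\in G$. $V$ is an $R$-module (carrying an anisotropic quadratic form $q$ with bilinear companion $b$, i.e. $q(\lambda x)=\lambda^2q(x)$, $q(x+y)=q(x)+q(y)+b(x,y)$, and $q(x)\neq 0$ for $x\ne0$). A ray in $V$ is a class of the equivalence relation on $V\setminus\{0\}$: $x\sim y$ iff $\lambda x=\mu y$ for some $\lambda,\mu\in R\setminus\{0\}$; $\mathrm{ray}(x)$ is the class of $x$. For rays $Y_1=\mathrm{ray}(\varepsilon_1)$, $Y_2=\mathrm{ray}(\varepsilon_2)$, the closed interval $[Y_1,Y_2]$ is the set of all rays $\mathrm{ray}(\lambda\varepsilon_1+\mu\varepsilon_2)$, $\lambda,\mu\in R$ not both $0$; $\pi$ maps $[0,\infty]$ onto it. A function $g:C\to[0,\infty]$ on a convex subset $C$ of $[0,\infty]$ is monomial (of degree $j\in\mathbb Z$) if $g(\lambda)=\gamma\lambda^j$ on $C$ for a fixed $\gamma\in R\setminus\{0\}$ (with $\lambda^0=1$ for all $\lambda$). A function $g:[u,v]\to[0,\infty]$, $u<v$, is piecewise monomial if there is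 a finite sequence $u=\beta_0<\dots<\beta_r=v$ with all restrictions $g|[\beta_{s-1},\beta_s]$ monomial. A function $F:[Y_1,Y_2]\to[0,\infty]$ is piecewise monomial if $F\circ\pi$ is piecewise monomial on $[0,\infty]$ (this does not depend on the choice of $\varepsilon_1,\varepsilon_2$). *)

theory Defs
  imports Main
begin

section \<open>Bipotent semifields\<close>

text \<open>
  The element \<open>0\<close> is absorbing by \<^class>\<open>comm_semiring_1\<close>, and \<open>0\<close> is the least element and
  multiplication is monotone because addition is the maximum; so the nonzero elements form a totally
  ordered abelian group. The value of \<open>inverse 0\<close> inside \<open>R\<close> is the usual totalization
  of HOL; the convention \<open>0\<^sup>-\<^sup>1 = \<infinity>\<close> is that of \<open>ext_inverse\<close> below.
\<close>

class bipotent_semifield = comm_semiring_1 + inverse + linorder +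
  assumes add_eq_max: "x + y = max x y"
    and left_inverse_nonzero: "x \<noteq> 0 \<Longrightarrow> inverse x * x = 1"
    and inverse_zero_eq: "inverse 0 = 0"
    and divide_eq_mult_inverse: "x / y = x * inverse y"
    and nontrivial_group: "\<exists>x. x \<noteq> 0 \<and> x \<noteq> 1"

class root_closed_bipotent_semifield = bipotent_semifield +
  assumes ex_root: "n \<ge> 1 \<Longrightarrow> \<exists>y. y ^ n = x"


section \<open>The extended half line \<open>[0,\<infinity>]\<close>\<close>

datatype 'r ext = Fin 'r | Infty

instantiation ext :: (linorder) linorder
begin

definition less_eq_ext :: "'a ext \<Rightarrow> 'a ext \<Rightarrow> bool" where
  "less_eq_ext x y \<longleftrightarrow>
     (case y of Infty \<Rightarrow> True | Fin b \<Rightarrow> (case x of Infty \<Rightarrow> False | Fin a \<Rightarrow> a \<le> b))"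

definition less_ext :: "'a ext \<Rightarrow> 'a ext \<Rightarrow> bool" where
  "less_ext x y \<longleftrightarrow> x \<le> y \<and> \<not> y \<le> x"

instance
  by standard (auto simp: less_eq_ext_def less_ext_def split: ext.splits)

end

definition ext_inverse :: "'r::bipotent_semifield ext \<Rightarrow> 'r ext" where
  "ext_inverse x =
     (case x of Fin a \<Rightarrow> (if a = 0 then Infty else Fin (inverse a)) | Infty \<Rightarrow> Fin 0)"

definition ext_power :: "'r::bipotent_semifield ext \<Rightarrow> nat \<Rightarrow> 'r ext" where
  "ext_power x n =
     (case x of Fin a \<Rightarrow> Fin (a ^ n) | Infty \<Rightarrow> (if n = 0 then Fin 1 else Infty))"

definition ext_power_int :: "'r::bipotent_semifield ext \<Rightarrow> int \<Rightarrow> 'r ext" where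
  "ext_power_int x j =
     (if j \<ge> 0 then ext_power x (nat j) else ext_power (ext_inverse x) (nat (- j)))"

text \<open>The product of a scalar and an extended scalar; only used for a scalar \<open>c \<noteq> 0\<close>.\<close>

definition ext_scale :: "'r::bipotent_semifield \<Rightarrow> 'r ext \<Rightarrow> 'r ext" where
  "ext_scale c x = (case x of Fin a \<Rightarrow> Fin (c * a) | Infty \<Rightarrow> Infty)"


section \<open>Monomial and piecewise monomial functions on \<open>[0,\<infinity>]\<close>\<close>

text \<open>As usual, functions on a subset are total functions of which only the values on that subset
  are considered.\<close>

definition monomial_on :: "'r::bipotent_semifield ext set \<Rightarrow> ('r ext \<Rightarrow> 'r ext) \<Rightarrow> bool" where
  "monomial_on C g \<longleftrightarrow>
     (\<exists>c j. c \<noteq> 0 \<and> (\<forall>x\<in>C. g x = ext_scale c (ext_power_int x j)))"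

definition piecewise_monomial_on ::
    "'r::bipotent_semifield ext \<Rightarrow> 'r ext \<Rightarrow> ('r ext \<Rightarrow> 'r ext) \<Rightarrow> bool" where
  "piecewise_monomial_on u v g \<longleftrightarrow>
     u < v \<and>
     (\<exists>r \<beta>. \<beta> 0 = u \<and> \<beta> r = v \<and>
        (\<forall>s\<in>{1..r::nat}. \<beta> (s - 1) < \<beta> s \<and> monomial_on {\<beta> (s - 1)..\<beta> s} g))"


section \<open>Modules and anisotropic quadratic forms over a bipotent semifield\<close>

locale semifield_module =
  fixes scale :: "'r::bipotent_semifield \<Rightarrow> 'v::comm_monoid_add \<Rightarrow> 'v"
  assumes scale_add_right: "scale a (x + y) = scale a x + scale a y"
    and scale_add_left: "scale (a + b) x = scale a x + scale b x"
    and scale_scale: "scale a (scale b x) = scale (a * b) x"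
    and scale_one: "scale 1 x = x"
    and scale_zero_left: "scale 0 x = 0"
    and scale_zero_right: "scale a 0 = 0"

definition bilinear_form ::
    "('r::bipotent_semifield \<Rightarrow> 'v::comm_monoid_add \<Rightarrow> 'v) \<Rightarrow> ('v \<Rightarrow> 'v \<Rightarrow> 'r) \<Rightarrow> bool" where
  "bilinear_form scale b \<longleftrightarrow>
     (\<forall>x y z. b (x + y) z = b x z + b y z \<and> b z (x + y) = b z x + b z y) \<and>
     (\<forall>a x y. b (scale a x) y = a * b x y \<and> b x (scale a y) = a * b x y)"

definition quadratic_form_with_companion ::
    "('r::bipotent_semifield \<Rightarrow> 'v::comm_monoid_add \<Rightarrow> 'v) \<Rightarrow> ('v \<Rightarrow> 'r) \<Rightarrow> ('v \<Rightarrow> 'v \<Rightarrow> 'r) \<Rightarrow> bool"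
  where
  "quadratic_form_with_companion scale q b \<longleftrightarrow>
     bilinear_form scale b \<and>
     (\<forall>a x. q (scale a x) = a ^ 2 * q x) \<and>
     (\<forall>x y. q (x + y) = q x + q y + b x y)"

definition anisotropic :: "('v::zero \<Rightarrow> 'r::zero) \<Rightarrow> bool" where
  "anisotropic q \<longleftrightarrow> (\<forall>x. x \<noteq> 0 \<longrightarrow> q x \<noteq> 0)"


section \<open>Rays and intervals of rays\<close>

definition ray_rel ::
    "('r::bipotent_semifield \<Rightarrow> 'v::comm_monoid_add \<Rightarrow> 'v) \<Rightarrow> ('v \<times> 'v) set" where
  "ray_rel scale =
     {(x, y). x \<noteq> 0 \<and> y \<noteq> 0 \<and> (\<exists>a c. a \<noteq> 0 \<and> c \<noteq> 0 \<and> scale a x = scale c y)}"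

definition rays :: "('r::bipotent_semifield \<Rightarrow> 'v::comm_monoid_add \<Rightarrow> 'v) \<Rightarrow> 'v set set" where
  "rays scale = (UNIV - {0}) // ray_rel scale"

definition ray :: "('r::bipotent_semifield \<Rightarrow> 'v::comm_monoid_add \<Rightarrow> 'v) \<Rightarrow> 'v \<Rightarrow> 'v set" where
  "ray scale x = ray_rel scale `` {x}"

text \<open>All choices of representatives are allowed here; each single choice
  already yields the whole interval (\<open>ray_interval_eq\<close> below).\<close>

definition ray_interval ::
    "('r::bipotent_semifield \<Rightarrow> 'v::comm_monoid_add \<Rightarrow> 'v) \<Rightarrow> 'v set \<Rightarrow> 'v set \<Rightarrow> 'v set set" where
  "ray_interval scale Y1 Y2 =
     {ray scale (scale a e1 + scale c e2) | a c e1 e2. e1 \<in> Y1 \<and> e2 \<in> Y2 \<and> (a \<noteq> 0 \<or> c \<noteq> 0)}"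

definition ray_param ::
    "('r::bipotent_semifield \<Rightarrow> 'v::comm_monoid_add \<Rightarrow> 'v) \<Rightarrow> 'v \<Rightarrow> 'v \<Rightarrow> 'r ext \<Rightarrow> 'v set" where
  "ray_param scale e1 e2 x =
     (case x of Fin a \<Rightarrow> ray scale (e1 + scale a e2) | Infty \<Rightarrow> ray scale e2)"

text \<open>The choice of the representatives is immaterial
  (\<open>piecewise_monomial_on_rays_iff\<close> below).\<close>

definition piecewise_monomial_on_rays ::
    "('r::bipotent_semifield \<Rightarrow> 'v::comm_monoid_add \<Rightarrow> 'v) \<Rightarrow> 'v set \<Rightarrow> 'v set \<Rightarrow> ('v set \<Rightarrow> 'r ext) \<Rightarrow> bool"
  where
  "piecewise_monomial_on_rays scale Y1 Y2 F \<longleftrightarrow>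
     (\<exists>e1\<in>Y1. \<exists>e2\<in>Y2. piecewise_monomial_on (Fin 0) Infty (F \<circ> ray_param scale e1 e2))"


section \<open>Independence of the choice of representatives\<close>

lemma mult_nonzero:
  fixes a b :: "'r::bipotent_semifield"
  assumes "a \<noteq> 0" and "b \<noteq> 0"
  shows "a * b \<noteq> 0"
proof
  assume "a * b = 0"
  then have "inverse a * a * b = 0" by (simp add: mult.assoc)
  then show False using assms by (simp add: left_inverse_nonzero)
qed

lemma inverse_nonzero: "(a::'r::bipotent_semifield) \<noteq> 0 \<Longrightarrow> inverse a \<noteq> 0"
  using left_inverse_nonzero[of a] by auto

lemma power_nonzero: "(a::'r::bipotent_semifield) \<noteq> 0 \<Longrightarrow> a ^ n \<noteq> 0"
  by (induction n) (auto simp: mult_nonzero)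

lemma mult_left_mono_semifield:
  fixes a x y :: "'r::bipotent_semifield"
  assumes "x \<le> y"
  shows "a * x \<le> a * y"
proof -
  have "a * x + a * y = a * y"
    using assms distrib_left[of a x y] by (simp add: add_eq_max max_absorb2)
  then show ?thesis by (metis add_eq_max max.cobounded1)
qed

lemma inverse_mult_semifield:
  fixes a b :: "'r::bipotent_semifield"
  assumes "a \<noteq> 0" and "b \<noteq> 0"
  shows "inverse (a * b) = inverse a * inverse b"
proof -
  have "inverse (a * b) = inverse (a * b) * ((inverse a * a) * (inverse b * b))"
    using assms by (simp add: left_inverse_nonzero)
  also have "\<dots> = (inverse (a * b) * (a * b)) * (inverse a * inverse b)"
    by (simp add: ac_simps)
  also have "\<dots> = inverse a * inverse b"
    using assms by (simp add: left_inverse_nonzero mult_nonzero)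
  finally show ?thesis .
qed

lemma ext_scale_mono: "x \<le> y \<Longrightarrow> ext_scale d x \<le> ext_scale d y"
  by (auto simp: less_eq_ext_def ext_scale_def mult_left_mono_semifield split: ext.splits)

lemma ext_scale_ext_scale: "ext_scale a (ext_scale b x) = ext_scale (a * b) x"
  by (auto simp: ext_scale_def mult.assoc split: ext.splits)

lemma ext_scale_one: "ext_scale 1 x = x"
  by (auto simp: ext_scale_def split: ext.splits)

lemma ext_scale_inverse:
  assumes "d \<noteq> 0"
  shows "ext_scale d (ext_scale (inverse d) x) = x"
    and "ext_scale (inverse d) (ext_scale d x) = x"
  using left_inverse_nonzero[OF assms]
  by (auto simp: ext_scale_ext_scale ext_scale_one mult.commute[of d])

lemma ext_power_ext_scale:
  "ext_power (ext_scale d x) n = ext_scale (d ^ n) (ext_power x n)" if "n > 0 \<or> x \<noteq> Infty"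
  using that by (auto simp: ext_power_def ext_scale_def power_mult_distrib split: ext.splits)

lemma ext_inverse_ext_scale:
  "d \<noteq> 0 \<Longrightarrow> ext_inverse (ext_scale d x) = ext_scale (inverse d) (ext_inverse x)"
  using mult_nonzero[of d]
  by (auto simp: ext_inverse_def ext_scale_def inverse_mult_semifield split: ext.splits)

lemma ext_power_int_ext_scale:
  assumes "d \<noteq> 0"
  obtains c where "c \<noteq> 0" "\<And>x. ext_power_int (ext_scale d x) j = ext_scale c (ext_power_int x j)"
proof -
  consider "j = 0" | "j > 0" | "j < 0" by linarith
  then show thesis
  proof cases
    case 1
    then have "ext_power_int (ext_scale d x) j = ext_scale 1 (ext_power_int x j)" for x
      by (auto simp: ext_power_int_def ext_power_def ext_scale_def split: ext.splits)
    then show thesis using that[of 1] by simp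
  next
    case 2
    then show thesis
      using that[of "d ^ nat j"] assms
      by (simp add: ext_power_int_def ext_power_ext_scale power_nonzero)
  next
    case 3
    then show thesis
      using that[of "inverse d ^ nat (- j)"] assms
      by (simp add: ext_power_int_def ext_inverse_ext_scale ext_power_ext_scale
          power_nonzero inverse_nonzero)
  qed
qed

lemma monomial_on_ext_scale:
  assumes "d \<noteq> 0" and "monomial_on {u..v} g"
  shows "monomial_on {ext_scale (inverse d) u..ext_scale (inverse d) v} (g \<circ> ext_scale d)"
proof -
  obtain c j where c: "c \<noteq> 0" "\<And>x. x \<in> {u..v} \<Longrightarrow> g x = ext_scale c (ext_power_int x j)"
    using assms(2) by (auto simp: monomial_on_def)
  obtain c' where c': "c' \<noteq> 0"
      "\<And>x. ext_power_int (ext_scale d x) j = ext_scale c' (ext_power_int x j)"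
    using ext_power_int_ext_scale[OF assms(1)] by metis
  have "(g \<circ> ext_scale d) x = ext_scale (c * c') (ext_power_int x j)"
    if "x \<in> {ext_scale (inverse d) u..ext_scale (inverse d) v}" for x
  proof -
    have "ext_scale d x \<in> {u..v}"
      using that ext_scale_mono[of "ext_scale (inverse d) u" x d]
        ext_scale_mono[of x "ext_scale (inverse d) v" d]
      by (simp add: ext_scale_inverse assms(1))
    then show ?thesis using c(2) c'(2) by (simp add: ext_scale_ext_scale)
  qed
  then show ?thesis using mult_nonzero[OF c(1) c'(1)] unfolding monomial_on_def by blast
qed

lemma piecewise_monomial_on_ext_scale:
  assumes "d \<noteq> 0" and "piecewise_monomial_on u v g"
  shows "piecewise_monomial_on (ext_scale (inverse d) u) (ext_scale (inverse d) v) (g \<circ> ext_scale d)"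
proof -
  have less: "ext_scale (inverse d) x < ext_scale (inverse d) y" if "x < y" for x y
    using that ext_scale_mono[of "ext_scale (inverse d) y" "ext_scale (inverse d) x" d]
    by (auto simp: ext_scale_inverse assms(1) simp flip: not_le)
  obtain r \<beta> where \<beta>: "u < v" "\<beta> 0 = u" "\<beta> r = v"
      "\<And>s. s \<in> {1..r::nat} \<Longrightarrow> \<beta> (s - 1) < \<beta> s \<and> monomial_on {\<beta> (s - 1)..\<beta> s} g"
    using assms(2) by (auto simp: piecewise_monomial_on_def)
  show ?thesis
    unfolding piecewise_monomial_on_def
    using \<beta> less monomial_on_ext_scale[OF assms(1)]
    by (intro conjI exI[of _ r] exI[of _ "\<lambda>s. ext_scale (inverse d) (\<beta> s)"]) auto
qed

context semifield_module
begin

lemma scale_inverse: "a \<noteq> 0 \<Longrightarrow> scale (inverse a) (scale a x) = x"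
  by (simp add: scale_scale left_inverse_nonzero scale_one)

lemma scale_nonzero: "a \<noteq> 0 \<Longrightarrow> x \<noteq> 0 \<Longrightarrow> scale a x \<noteq> 0"
  using scale_inverse[of a x] by (auto simp: scale_zero_right)

lemma equiv_ray_rel: "equiv (UNIV - {0}) (ray_rel scale)"
proof (rule equivI)
  show "refl_on (UNIV - {0}) (ray_rel scale)"
    unfolding refl_on_def ray_rel_def using one_neq_zero by blast
  show "ray_rel scale \<subseteq> (UNIV - {0}) \<times> (UNIV - {0})"
    by (auto simp: ray_rel_def)
  show "sym (ray_rel scale)"
    unfolding sym_def ray_rel_def by (auto, metis)
  show "trans (ray_rel scale)"
  proof (rule transI)
    fix x y z
    assume "(x, y) \<in> ray_rel scale" "(y, z) \<in> ray_rel scale"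
    then obtain a c a' c' where *: "x \<noteq> 0" "z \<noteq> 0" "a \<noteq> 0" "c \<noteq> 0" "a' \<noteq> 0" "c' \<noteq> 0"
        "scale a x = scale c y" "scale a' y = scale c' z"
      by (auto simp: ray_rel_def)
    have "scale (a' * a) x = scale (c * c') z"
      by (metis *(7,8) scale_scale mult.commute)
    then show "(x, z) \<in> ray_rel scale"
      using * mult_nonzero unfolding ray_rel_def by blast
  qed
qed

lemma ray_scale: assumes "d \<noteq> 0" shows "ray scale (scale d x) = ray scale x"
proof (cases "x = 0")
  case False
  have "scale 1 (scale d x) = scale d x" by (simp add: scale_one)
  then have "(scale d x, x) \<in> ray_rel scale"
    using assms False scale_nonzero[OF assms False] one_neq_zero unfolding ray_rel_def by blast
  then show ?thesis unfolding ray_def by (rule equiv_class_eq[OF equiv_ray_rel])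
qed (simp add: scale_zero_right)

lemma ray_elements:
  assumes "Y \<in> rays scale" and "x \<in> Y" and "y \<in> Y"
  obtains d where "d \<noteq> 0" "y = scale d x"
proof -
  have "(x, y) \<in> ray_rel scale"
    using quotient_eqI[OF equiv_ray_rel] assms in_quotient_imp_in_rel[OF equiv_ray_rel]
    unfolding rays_def by blast
  then obtain a c where ac: "a \<noteq> 0" "c \<noteq> 0" "scale a x = scale c y"
    by (auto simp: ray_rel_def)
  then have "y = scale (inverse c * a) x"
    by (metis scale_inverse scale_scale)
  then show thesis using ac that mult_nonzero inverse_nonzero by blast
qed

lemma ray_interval_eq:
  assumes "Y1 \<in> rays scale" "Y2 \<in> rays scale" "e1 \<in> Y1" "e2 \<in> Y2"
  shows "ray_interval scale Y1 Y2 =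
           {ray scale (scale a e1 + scale c e2) | a c. a \<noteq> 0 \<or> c \<noteq> 0}"
proof (intro equalityI subsetI)
  fix Z assume "Z \<in> ray_interval scale Y1 Y2"
  then obtain a c f1 f2 where Z: "Z = ray scale (scale a f1 + scale c f2)" "f1 \<in> Y1" "f2 \<in> Y2"
      "a \<noteq> 0 \<or> c \<noteq> 0"
    unfolding ray_interval_def by blast
  obtain d1 where d1: "d1 \<noteq> 0" "f1 = scale d1 e1" using ray_elements assms Z by metis
  obtain d2 where d2: "d2 \<noteq> 0" "f2 = scale d2 e2" using ray_elements assms Z by metis
  have "Z = ray scale (scale (a * d1) e1 + scale (c * d2) e2)" "a * d1 \<noteq> 0 \<or> c * d2 \<noteq> 0"
    using Z d1 d2 mult_nonzero by (auto simp: scale_scale)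
  then show "Z \<in> {ray scale (scale a e1 + scale c e2) | a c. a \<noteq> 0 \<or> c \<noteq> 0}" by blast
next
  fix Z assume "Z \<in> {ray scale (scale a e1 + scale c e2) | a c. a \<noteq> 0 \<or> c \<noteq> 0}"
  then show "Z \<in> ray_interval scale Y1 Y2" using assms unfolding ray_interval_def by blast
qed

lemma ray_param_change:
  assumes "c \<noteq> 0" "d \<noteq> 0"
  shows "ray_param scale (scale c e1) (scale d e2) = ray_param scale e1 e2 \<circ> ext_scale (inverse c * d)"
proof
  fix x
  show "ray_param scale (scale c e1) (scale d e2) x
      = (ray_param scale e1 e2 \<circ> ext_scale (inverse c * d)) x"
  proof (cases x)
    case (Fin a)
    have "c * (inverse c * d * a) = (inverse c * c) * (a * d)" by (simp add: ac_simps)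
    then have "scale c e1 + scale a (scale d e2) = scale c (e1 + scale (inverse c * d * a) e2)"
      using assms by (simp add: scale_add_right scale_scale left_inverse_nonzero)
    then show ?thesis using assms Fin by (simp add: ray_param_def ext_scale_def ray_scale)
  qed (simp add: ray_param_def ext_scale_def ray_scale assms)
qed

lemma piecewise_monomial_on_rays_iff:
  assumes "Y1 \<in> rays scale" "Y2 \<in> rays scale" "e1 \<in> Y1" "e2 \<in> Y2"
  shows "piecewise_monomial_on_rays scale Y1 Y2 F \<longleftrightarrow>
           piecewise_monomial_on (Fin 0) Infty (F \<circ> ray_param scale e1 e2)"
proof
  assume "piecewise_monomial_on_rays scale Y1 Y2 F"
  then obtain f1 f2 where f: "f1 \<in> Y1" "f2 \<in> Y2"
      "piecewise_monomial_on (Fin 0) Infty (F \<circ> ray_param scale f1 f2)"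
    unfolding piecewise_monomial_on_rays_def by blast
  obtain c where c: "c \<noteq> 0" "e1 = scale c f1" using ray_elements assms f by metis
  obtain d where d: "d \<noteq> 0" "e2 = scale d f2" using ray_elements assms f by metis
  have "inverse c * d \<noteq> 0" using c d inverse_nonzero mult_nonzero by blast
  from piecewise_monomial_on_ext_scale[OF this f(3)] c d
  show "piecewise_monomial_on (Fin 0) Infty (F \<circ> ray_param scale e1 e2)"
    by (simp add: ray_param_change ext_scale_def comp_assoc)
qed (use assms in \<open>auto simp: piecewise_monomial_on_rays_def\<close>)

end

end

theory Submission
  imports Defs
begin

text \<open>
  The formula of a monomial function defines a constant, an order isomorphism or an order
  anti-isomorphism of \<open>[0,\<infinity>]\<close>; this is where root closedness enters, since it makes every power map with nonzero exponent surjective.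
  Hence a monomial function maps an interval onto the interval between its values at the two
  endpoints (\<open>monomial_image_interval\<close>), which replaces the intermediate value theorem.

  For (a), consecutive pieces share an endpoint, so the intervals onto which they are mapped
  overlap, and their union is the interval between the least and the greatest breakpoint value
  (\<open>image_of_monomial_pieces\<close>). The breakpoints in (a) need not start at \<open>0\<close> and end at \<open>\<infinity>\<close>, as
  \<open>\<pi>\<close> need not be injective; but \<open>\<pi>\<close> is constant on \<open>[0,\<alpha>\<^sub>0]\<close> and on \<open>[\<alpha>\<^sub>r,\<infinity>]\<close>
  (\<open>ray_param_constant_below\<close>, \<open>ray_param_constant_above\<close>), so no value of \<open>F\<close> is lost.

  For (b), the composition of two monomials is a monomial. Whenever a breakpoint of \<open>\<phi>\<close> lies strictly
  between the endpoint values of a monomial piece of \<open>f = F \<circ> \<pi>\<close>, it is a value of \<open>f\<close> there, and the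
  piece can be cut at a preimage. Two inductions over the pieces of \<open>\<phi>\<close> and of \<open>f\<close>, both in the
  form of gluing adjacent intervals, give the claim (\<open>piecewise_monomial_on_compose\<close>).
\<close>

section \<open>Order and powers in a bipotent semifield\<close>

lemma zero_le_semifield: "(0::'r::bipotent_semifield) \<le> x"
  using add_eq_max[of 0 x] by (simp add: max_def split: if_splits)

lemma add_nonzero_left: "(x::'r::bipotent_semifield) \<noteq> 0 \<Longrightarrow> x + y \<noteq> 0"
  using zero_le_semifield[of x] zero_le_semifield[of y] by (auto simp: add_eq_max max_def)

lemma mult_inverse_nonzero: "(x::'r::bipotent_semifield) \<noteq> 0 \<Longrightarrow> x * inverse x = 1"
  using left_inverse_nonzero[of x] by (simp add: mult.commute)

lemma power_mono_semifield:
  fixes a b :: "'r::bipotent_semifield"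
  assumes "a \<le> b"
  shows "a ^ n \<le> b ^ n"
proof (induction n)
  case (Suc n)
  have "a * a ^ n \<le> a * b ^ n" by (rule mult_left_mono_semifield[OF Suc])
  also have "a * b ^ n \<le> b * b ^ n"
    using mult_left_mono_semifield[OF assms, of "b ^ n"] by (simp add: mult.commute)
  finally show ?case by simp
qed simp

lemma inverse_antimono_semifield:
  fixes a b :: "'r::bipotent_semifield"
  assumes "a \<le> b" and "a \<noteq> 0"
  shows "inverse b \<le> inverse a"
proof -
  have "b \<noteq> 0" using assms zero_le_semifield[of a] by auto
  have "(inverse a * inverse b) * a \<le> (inverse a * inverse b) * b"
    by (rule mult_left_mono_semifield[OF assms(1)])
  moreover have "(inverse a * inverse b) * a = (inverse a * a) * inverse b"
    by (simp add: ac_simps)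
  moreover have "(inverse a * inverse b) * b = inverse a * (inverse b * b)"
    by (simp add: ac_simps)
  ultimately show ?thesis using assms(2) \<open>b \<noteq> 0\<close> by (simp add: left_inverse_nonzero)
qed

lemma inverse_inverse_semifield: "inverse (inverse a) = (a::'r::bipotent_semifield)"
proof (cases "a = 0")
  case False
  then have "inverse (inverse a) = inverse (inverse a) * (inverse a * a)"
    by (simp add: left_inverse_nonzero)
  also have "\<dots> = (inverse (inverse a) * inverse a) * a" by (simp add: ac_simps)
  finally show ?thesis using False by (simp add: left_inverse_nonzero inverse_nonzero)
qed (simp add: inverse_zero_eq)

lemma inverse_one_semifield: "inverse 1 = (1::'r::bipotent_semifield)"
  using left_inverse_nonzero[of "1::'r"] by simp

lemma inverse_power_semifield:
  "(a::'r::bipotent_semifield) \<noteq> 0 \<Longrightarrow> inverse (a ^ n) = inverse a ^ n"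
  by (induction n) (auto simp: inverse_one_semifield inverse_mult_semifield power_nonzero)


section \<open>Monomials on the extended half line\<close>

lemma ext_whole_interval: "{Fin (0::'r::bipotent_semifield)..Infty} = UNIV"
  by (auto simp: less_eq_ext_def zero_le_semifield split: ext.splits)

lemma ext_inverse_inverse: "ext_inverse (ext_inverse x) = x"
  by (auto simp: ext_inverse_def inverse_inverse_semifield inverse_nonzero split: ext.splits)

lemma antimono_ext_inverse: "antimono ext_inverse"
proof (rule antimonoI)
  fix x y :: "'r::bipotent_semifield ext"
  assume "x \<le> y"
  moreover have "a \<le> 0 \<longleftrightarrow> a = 0" for a :: 'r using zero_le_semifield[of a] by auto
  ultimately show "ext_inverse y \<le> ext_inverse x"
    by (auto simp: less_eq_ext_def ext_inverse_def zero_le_semifield inverse_antimono_semifield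
        split: ext.splits)
qed

lemma mono_ext_power: "mono (\<lambda>x. ext_power x n)"
  by (rule monoI)
    (auto simp: less_eq_ext_def ext_power_def power_mono_semifield split: ext.splits)

lemma surj_ext_power:
  assumes "n \<ge> 1"
  shows "surj (\<lambda>x::'r::root_closed_bipotent_semifield ext. ext_power x n)"
proof -
  have "\<exists>x::'r ext. y = ext_power x n" for y
  proof (cases y)
    case (Fin a)
    obtain t where "t ^ n = a" using ex_root[OF assms] by blast
    then have "y = ext_power (Fin t) n" using Fin by (simp add: ext_power_def)
    then show ?thesis ..
  next
    case Infty
    then have "y = ext_power Infty n" using assms by (simp add: ext_power_def)
    then show ?thesis ..
  qed
  then show ?thesis unfolding surj_def by blast
qed

lemma ext_power_power: "ext_power (ext_power x m) n = ext_power x (m * n)"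
  by (auto simp: ext_power_def power_mult split: ext.splits)

lemma ext_inverse_power: "ext_inverse (ext_power x n) = ext_power (ext_inverse x) n"
  by (cases "n = 0")
    (auto simp: ext_inverse_def ext_power_def inverse_power_semifield inverse_one_semifield
      power_nonzero power_0_left split: ext.splits)

text \<open>The law holds at \<open>0\<close> and \<open>\<infinity>\<close> as well: exponent \<open>0\<close> gives \<open>1\<close> on both sides, and with nonzero
  exponents the two points are exchanged or fixed according to the signs. So monomials compose to
  monomials without exceptional points.\<close>

lemma ext_power_int_power_int: "ext_power_int (ext_power_int x j) k = ext_power_int x (j * k)"
proof -
  have one: "ext_power (y::'a ext) 0 = Fin 1" for y
    by (auto simp: ext_power_def split: ext.splits)
  consider "j = 0 \<or> k = 0" | "j > 0" "k > 0" | "j > 0" "k < 0" | "j < 0" "k > 0" | "j < 0" "k < 0"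
    by linarith
  then show ?thesis
  proof cases
    case 1
    then show ?thesis
      by (auto simp: ext_power_int_def one)
        (auto simp: ext_power_def ext_inverse_def inverse_one_semifield)
  next
    case 2
    then show ?thesis by (simp add: ext_power_int_def ext_power_power nat_mult_distrib)
  next
    case 3
    then have "nat (- (j * k)) = nat j * nat (- k)" by (simp flip: nat_mult_distrib)
    then show ?thesis using 3 mult_pos_neg[of j k]
      by (simp add: ext_power_int_def ext_power_power ext_inverse_power)
  next
    case 4
    then have "nat (- (j * k)) = nat (- j) * nat k" by (simp flip: nat_mult_distrib)
    then show ?thesis using 4 mult_neg_pos[of j k]
      by (simp add: ext_power_int_def ext_power_power)
  next
    case 5
    then have "nat (j * k) = nat (- j) * nat (- k)" by (simp flip: nat_mult_distrib)
    then show ?thesis using 5 mult_neg_neg[of j k]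
      by (simp add: ext_power_int_def ext_power_power ext_inverse_power ext_inverse_inverse)
  qed
qed

lemma monomial_on_subset: "monomial_on C g \<Longrightarrow> D \<subseteq> C \<Longrightarrow> monomial_on D g"
  unfolding monomial_on_def by blast

lemma monomial_on_compose:
  assumes "monomial_on C f" and "monomial_on D g" and "f ` C \<subseteq> D"
  shows "monomial_on C (g \<circ> f)"
proof -
  obtain c j where c: "c \<noteq> 0" "\<And>x. x \<in> C \<Longrightarrow> f x = ext_scale c (ext_power_int x j)"
    using assms(1) by (auto simp: monomial_on_def)
  obtain d k where d: "d \<noteq> 0" "\<And>x. x \<in> D \<Longrightarrow> g x = ext_scale d (ext_power_int x k)"
    using assms(2) by (auto simp: monomial_on_def)
  obtain c' where c': "c' \<noteq> 0"
      "\<And>x. ext_power_int (ext_scale c x) k = ext_scale c' (ext_power_int x k)"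
    using ext_power_int_ext_scale[OF c(1)] by metis
  have "(g \<circ> f) x = ext_scale (d * c') (ext_power_int x (j * k))" if "x \<in> C" for x
  proof -
    have "f x \<in> D" using assms(3) that by blast
    then show ?thesis
      using that by (simp add: c(2) d(2) c'(2) ext_scale_ext_scale ext_power_int_power_int)
  qed
  then show ?thesis using mult_nonzero[OF d(1) c'(1)] unfolding monomial_on_def by blast
qed

text \<open>A monotone surjection has no jumps: a preimage of a value between \<open>g a\<close> and \<open>g b\<close> that lies
  outside \<open>[a,b]\<close> forces that value to be \<open>g a\<close> or \<open>g b\<close>.\<close>

lemma mono_surj_image_interval:
  fixes g :: "'a::linorder \<Rightarrow> 'b::linorder"
  assumes "mono g" "surj g" "a \<le> b"
  shows "g ` {a..b} = {g a..g b}"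
proof
  show "g ` {a..b} \<subseteq> {g a..g b}" using monoD[OF assms(1)] by auto
  show "{g a..g b} \<subseteq> g ` {a..b}"
  proof
    fix y assume y: "y \<in> {g a..g b}"
    obtain x where x: "y = g x" using assms(2) by blast
    consider "x < a" | "x \<in> {a..b}" | "b < x" by force
    then show "y \<in> g ` {a..b}"
    proof cases
      case 1
      then have "y = g a" using monoD[OF assms(1), of x a] x y by auto
      then show ?thesis using assms(3) by auto
    next
      case 3
      then have "y = g b" using monoD[OF assms(1), of b x] x y by auto
      then show ?thesis using assms(3) by auto
    qed (use x in blast)
  qed
qed

lemma surj_ext_scale: "c \<noteq> 0 \<Longrightarrow> surj (ext_scale c)"
  by (metis surjI ext_scale_inverse(1))

lemma image_ext_inverse: "ext_inverse ` {a..b} = {ext_inverse b..ext_inverse a}"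
proof
  show "ext_inverse ` {a..b} \<subseteq> {ext_inverse b..ext_inverse a}"
    using antimonoD[OF antimono_ext_inverse] by auto
  show "{ext_inverse b..ext_inverse a} \<subseteq> ext_inverse ` {a..b}"
  proof
    fix y assume "y \<in> {ext_inverse b..ext_inverse a}"
    then have "ext_inverse y \<in> {a..b}"
      using antimonoD[OF antimono_ext_inverse, of "ext_inverse b" y]
        antimonoD[OF antimono_ext_inverse, of y "ext_inverse a"]
      by (simp add: ext_inverse_inverse)
    then show "y \<in> ext_inverse ` {a..b}" by (metis image_eqI ext_inverse_inverse)
  qed
qed

text \<open>The substitute for the intermediate value theorem. For degree \<open>j > 0\<close> the monomial is a
  monotone surjection of \<open>[0,\<infinity>]\<close> because \<open>n\<close>-th roots exist; negative degrees reduce to this case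
  through \<open>\<lambda> \<mapsto> \<lambda>\<^sup>-\<^sup>1\<close>, which reverses intervals; degree \<open>0\<close> gives a single point.\<close>

lemma monomial_image_interval:
  fixes g :: "'r::root_closed_bipotent_semifield ext \<Rightarrow> 'r ext"
  assumes "monomial_on {a..b} g" and "a \<le> b"
  shows "g ` {a..b} = {min (g a) (g b)..max (g a) (g b)}"
proof -
  obtain c j where c: "c \<noteq> 0" and g: "\<And>x. x \<in> {a..b} \<Longrightarrow> g x = ext_scale c (ext_power_int x j)"
    using assms(1) by (auto simp: monomial_on_def)
  define h where "h n x = ext_scale c (ext_power x n)" for n and x :: "'r ext"
  have mono: "mono (h n)" for n
    unfolding h_def by (intro monoI ext_scale_mono monoD[OF mono_ext_power])
  have surj: "surj (h n)" if "n \<ge> 1" for n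
    using comp_surj[OF surj_ext_power[OF that] surj_ext_scale[OF c]]
    by (simp add: h_def comp_def)
  have ends: "a \<in> {a..b}" "b \<in> {a..b}" using assms(2) by auto
  consider "j = 0" | "j > 0" | "j < 0" by linarith
  then show ?thesis
  proof cases
    case 1
    then have "g x = g a" if "x \<in> {a..b}" for x
      using that ends by (simp add: g ext_power_int_def ext_power_def split: ext.splits)
    then have "g ` {a..b} = {g a}" "g b = g a" using ends by blast+
    then show ?thesis by simp
  next
    case 2
    then have g_h: "g x = h (nat j) x" if "x \<in> {a..b}" for x
      using that by (simp add: g h_def ext_power_int_def)
    then have "g ` {a..b} = h (nat j) ` {a..b}" by (rule image_cong[OF refl])
    also have "\<dots> = {g a..g b}"
      using mono_surj_image_interval[OF mono surj assms(2), of "nat j"] 2 g_h ends by simp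
    moreover have "g a \<le> g b" using monoD[OF mono assms(2)] g_h ends by simp
    ultimately show ?thesis by (simp add: min_absorb1 max_absorb2)
  next
    case 3
    have inv: "ext_inverse b \<le> ext_inverse a" by (rule antimonoD[OF antimono_ext_inverse assms(2)])
    have g_h: "g x = h (nat (- j)) (ext_inverse x)" if "x \<in> {a..b}" for x
      using that 3 by (simp add: g h_def ext_power_int_def)
    then have "g ` {a..b} = h (nat (- j)) ` ext_inverse ` {a..b}"
      by (simp add: image_image)
    also have "\<dots> = {g b..g a}"
      using mono_surj_image_interval[OF mono surj inv, of "nat (- j)"] 3 g_h ends
      by (simp add: image_ext_inverse)
    moreover have "g b \<le> g a" using monoD[OF mono inv] g_h ends by simp
    ultimately show ?thesis by (simp add: min_absorb2 max_absorb1)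
  qed
qed


section \<open>Piecewise monomial functions\<close>

lemma overlapping_intervals_Un:
  fixes m y z M :: "'a::linorder"
  assumes "m \<le> y" "y \<le> M"
  shows "{m..M} \<union> {min y z..max y z} = {min z m..max z M}"
proof (cases "y \<le> z")
  case True
  then have "min z m = m" "max z M = max M z" using assms by (auto simp: max.commute)
  then show ?thesis using True assms by (auto simp: le_max_iff_disj)
next
  case False
  then have "max z M = M" "min z m = min m z" using assms by (auto simp: min.commute)
  then show ?thesis using False assms by (auto simp: min_le_iff_disj)
qed

lemma breakpoints_mono:
  fixes \<beta> :: "nat \<Rightarrow> 'a::order"
  assumes "\<And>s. s \<in> {1..r} \<Longrightarrow> \<beta> (s - 1) < \<beta> s"
  shows "\<beta> 0 \<le> \<beta> r"
  using assms
proof (induction r)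
  case (Suc r)
  have "\<beta> 0 \<le> \<beta> r" by (rule Suc.IH) (use Suc.prems in auto)
  also have "\<beta> r < \<beta> (Suc r)" using Suc.prems[of "Suc r"] by simp
  finally show ?case by simp
qed simp

text \<open>The overlap that makes the union of the images an interval: the value at the breakpoint \<open>\<alpha>\<^sub>r\<close>
  belongs both to the image of \<open>[\<alpha>\<^sub>0,\<alpha>\<^sub>r]\<close> and to that of \<open>[\<alpha>\<^sub>r,\<alpha>\<^bsub>r+1\<^esub>]\<close>.\<close>

lemma image_of_monomial_pieces:
  fixes f :: "'r::root_closed_bipotent_semifield ext \<Rightarrow> 'r ext"
  assumes "\<And>s. s \<in> {1..r::nat} \<Longrightarrow> \<alpha> (s - 1) < \<alpha> s \<and> monomial_on {\<alpha> (s - 1)..\<alpha> s} f"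
  shows "f ` {\<alpha> 0..\<alpha> r} = {Min ((\<lambda>s. f (\<alpha> s)) ` {0..r})..Max ((\<lambda>s. f (\<alpha> s)) ` {0..r})}"
  using assms
proof (induction r)
  case (Suc r)
  let ?m = "Min ((\<lambda>s. f (\<alpha> s)) ` {0..r})" and ?M = "Max ((\<lambda>s. f (\<alpha> s)) ` {0..r})"
  let ?y = "f (\<alpha> r)" and ?z = "f (\<alpha> (Suc r))"
  have last: "\<alpha> r < \<alpha> (Suc r)" "monomial_on {\<alpha> r..\<alpha> (Suc r)} f"
    using Suc.prems[of "Suc r"] by auto
  have "\<alpha> 0 \<le> \<alpha> r" using breakpoints_mono[of r \<alpha>] Suc.prems by auto
  then have "{\<alpha> 0..\<alpha> (Suc r)} = {\<alpha> 0..\<alpha> r} \<union> {\<alpha> r..\<alpha> (Suc r)}"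
    using last(1) by auto
  then have "f ` {\<alpha> 0..\<alpha> (Suc r)} = {?m..?M} \<union> {min ?y ?z..max ?y ?z}"
    using Suc.IH[OF Suc.prems] monomial_image_interval[OF last(2)] last(1)
    by (simp add: image_Un)
  also have "\<dots> = {min ?z ?m..max ?z ?M}"
    by (rule overlapping_intervals_Un) auto
  also have "\<dots> = {Min ((\<lambda>s. f (\<alpha> s)) ` {0..Suc r})..Max ((\<lambda>s. f (\<alpha> s)) ` {0..Suc r})}"
    by (simp add: atLeastAtMostSuc_conv)
  finally show ?case .
qed simp

lemma piecewise_monomial_on_monomial:
  assumes "u < v" and "monomial_on {u..v} g"
  shows "piecewise_monomial_on u v g"
  unfolding piecewise_monomial_on_def
  using assms by (intro conjI exI[of _ 1] exI[of _ "\<lambda>s::nat. if s = 0 then u else v"]) auto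

lemma piecewise_monomial_on_glue:
  assumes "piecewise_monomial_on u w g" and "piecewise_monomial_on w v g"
  shows "piecewise_monomial_on u v g"
proof -
  obtain r \<beta> where \<beta>: "u < w" "\<beta> 0 = u" "\<beta> r = w"
      "\<And>s. s \<in> {1..r::nat} \<Longrightarrow> \<beta> (s - 1) < \<beta> s \<and> monomial_on {\<beta> (s - 1)..\<beta> s} g"
    using assms(1) by (auto simp: piecewise_monomial_on_def)
  obtain t \<gamma> where \<gamma>: "w < v" "\<gamma> 0 = w" "\<gamma> t = v"
      "\<And>s. s \<in> {1..t::nat} \<Longrightarrow> \<gamma> (s - 1) < \<gamma> s \<and> monomial_on {\<gamma> (s - 1)..\<gamma> s} g"
    using assms(2) by (auto simp: piecewise_monomial_on_def)
  define \<delta> where "\<delta> s = (if s \<le> r then \<beta> s else \<gamma> (s - r))" for s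
  have "\<delta> (s - 1) < \<delta> s \<and> monomial_on {\<delta> (s - 1)..\<delta> s} g" if s: "s \<in> {1..r + t}" for s
  proof (cases "s \<le> r")
    case True
    then have "\<delta> (s - 1) = \<beta> (s - 1)" "\<delta> s = \<beta> s" by (auto simp: \<delta>_def)
    then show ?thesis using \<beta>(4)[of s] s True by simp
  next
    case False
    then have "s - 1 \<le> r \<Longrightarrow> s - 1 = r" by auto
    then have "\<delta> (s - 1) = \<gamma> (s - r - 1)" "\<delta> s = \<gamma> (s - r)"
      using \<beta>(3) \<gamma>(2) False by (auto simp: \<delta>_def)
    moreover have "s - r \<in> {1..t}" using s False by auto
    ultimately show ?thesis using \<gamma>(4)[of "s - r"] by metis
  qed
  moreover have "\<delta> 0 = u" "\<delta> (r + t) = v" using \<beta> \<gamma> by (auto simp: \<delta>_def)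
  ultimately show ?thesis
    using less_trans[OF \<beta>(1) \<gamma>(1)] unfolding piecewise_monomial_on_def
    by (intro conjI exI[of _ "r + t"] exI[of _ \<delta>] ballI) blast+
qed

text \<open>With this rule, compositions can be treated by cutting and gluing intervals, without merging
  breakpoint sequences explicitly.\<close>

lemma piecewise_monomial_on_induct [consumes 1, case_names monomial glue]:
  assumes "piecewise_monomial_on u v g"
    and monomial: "\<And>u v. u < v \<Longrightarrow> monomial_on {u..v} g \<Longrightarrow> P u v"
    and glue: "\<And>u w v. u < w \<Longrightarrow> w < v \<Longrightarrow> P u w \<Longrightarrow> P w v \<Longrightarrow> P u v"
  shows "P u v"
proof -
  obtain r \<beta> where \<beta>: "u < v" "\<beta> 0 = u" "\<beta> r = v"
      "\<forall>s\<in>{1..r::nat}. \<beta> (s - 1) < \<beta> s \<and> monomial_on {\<beta> (s - 1)..\<beta> s} g"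
    using assms(1) by (auto simp: piecewise_monomial_on_def)
  have "P (\<beta> 0) (\<beta> r)" if "r > 0" using that \<beta>(4)
  proof (induction r)
    case (Suc r)
    have last: "\<beta> r < \<beta> (Suc r)" "P (\<beta> r) (\<beta> (Suc r))"
      using Suc.prems(2) monomial by (auto dest: bspec[of _ _ "Suc r"])
    show ?case
    proof (cases r)
      case (Suc r')
      have first: "P (\<beta> 0) (\<beta> r)" by (rule Suc.IH) (use Suc Suc.prems in auto)
      have "\<beta> 0 \<le> \<beta> r'" using breakpoints_mono[of r' \<beta>] Suc Suc.prems(2) by auto
      also have "\<beta> r' < \<beta> r" using Suc Suc.prems(2) by (auto dest: bspec[of _ _ "Suc r'"])
      finally show ?thesis using glue first last by blast
    qed (use last in simp)
  qed simp
  then show ?thesis using \<beta>(1-3) by (cases "r = 0") auto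
qed

text \<open>If the gluing point \<open>w\<close> of \<open>\<phi>\<close> lies strictly between the endpoint values of the monomial \<open>f\<close>, then
  \<open>w = f c\<close> for some \<open>c\<close> inside the interval, and \<open>f\<close> maps each of \<open>[a,c]\<close> and \<open>[c,b]\<close> to one side
  of \<open>w\<close>. As \<open>f\<close> is then restricted to \<open>[a,c]\<close> and \<open>[c,b]\<close>, the induction over \<open>\<phi>\<close> keeps \<open>a\<close> and
  \<open>b\<close> arbitrary.\<close>

lemma piecewise_monomial_on_compose_monomial:
  fixes f :: "'r::root_closed_bipotent_semifield ext \<Rightarrow> 'r ext"
  assumes "piecewise_monomial_on u v \<phi>"
    and "a < b" and "monomial_on {a..b} f" and "f a \<in> {u..v}" and "f b \<in> {u..v}"
  shows "piecewise_monomial_on a b (\<phi> \<circ> f)"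
  using assms
proof (induction arbitrary: a b rule: piecewise_monomial_on_induct)
  case (monomial u v)
  have "f ` {a..b} \<subseteq> {u..v}"
    using monomial_image_interval[OF monomial(4)] monomial(3,5,6) by simp
  then show ?case
    using piecewise_monomial_on_monomial[OF monomial(3)]
      monomial_on_compose[OF monomial(4) monomial(2)] by blast
next
  case (glue u w v)
  consider "f a \<le> w" "f b \<le> w" | "w \<le> f a" "w \<le> f b"
    | "f a < w" "w < f b" | "f b < w" "w < f a"
    by force
  then show ?case
  proof cases
    case 1
    then show ?thesis using glue by auto
  next
    case 2
    then show ?thesis using glue by auto
  next
    case 3
    then have "w \<in> f ` {a..b}"
      using monomial_image_interval[OF glue(6) less_imp_le[OF glue(5)]]
      by (simp add: min_le_iff_disj le_max_iff_disj less_imp_le)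
    then obtain c where c: "w = f c" "c \<in> {a..b}" by blast
    have "a < c" "c < b" using 3 c by (auto simp: order.order_iff_strict)
    moreover have "monomial_on {a..c} f" "monomial_on {c..b} f"
      by (rule monomial_on_subset[OF glue(6)], use c(2) in auto)+
    moreover have "f c \<in> {u..w}" "f c \<in> {w..v}" using c(1) glue(1,2) by auto
    moreover have "f a \<in> {u..w}" "f b \<in> {w..v}" using 3 glue(7,8) by auto
    ultimately show ?thesis
      using piecewise_monomial_on_glue[OF glue(3) glue(4), of a c b] by blast
  next
    case 4
    then have "w \<in> f ` {a..b}"
      using monomial_image_interval[OF glue(6) less_imp_le[OF glue(5)]]
      by (simp add: min_le_iff_disj le_max_iff_disj less_imp_le)
    then obtain c where c: "w = f c" "c \<in> {a..b}" by blast
    have "a < c" "c < b" using 4 c by (auto simp: order.order_iff_strict)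
    moreover have "monomial_on {a..c} f" "monomial_on {c..b} f"
      by (rule monomial_on_subset[OF glue(6)], use c(2) in auto)+
    moreover have "f c \<in> {u..w}" "f c \<in> {w..v}" using c(1) glue(1,2) by auto
    moreover have "f a \<in> {w..v}" "f b \<in> {u..w}" using 4 glue(7,8) by auto
    ultimately show ?thesis
      using piecewise_monomial_on_glue[OF glue(4) glue(3), of a c b] by blast
  qed
qed

lemma piecewise_monomial_on_compose:
  fixes f :: "'r::root_closed_bipotent_semifield ext \<Rightarrow> 'r ext"
  assumes "piecewise_monomial_on a b f" and "piecewise_monomial_on u v \<phi>"
    and "f ` {a..b} \<subseteq> {u..v}"
  shows "piecewise_monomial_on a b (\<phi> \<circ> f)"
  using assms(1,3)
proof (induction rule: piecewise_monomial_on_induct)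
  case (monomial a b)
  then have "f a \<in> {u..v}" "f b \<in> {u..v}" by (auto simp: image_subset_iff)
  then show ?case
    by (rule piecewise_monomial_on_compose_monomial[OF assms(2) monomial(1,2)])
next
  case (glue a c b)
  have "f ` {a..c} \<subseteq> {u..v}" "f ` {c..b} \<subseteq> {u..v}"
    using glue(1,2,5) by (auto simp: image_subset_iff)
  then show ?case by (rule piecewise_monomial_on_glue[OF glue(3,4)])
qed


section \<open>The parametrization of a ray interval\<close>

context semifield_module
begin

lemma ray_eq_of_mem: "Y \<in> rays scale \<Longrightarrow> e \<in> Y \<Longrightarrow> ray scale e = Y"
  unfolding ray_def rays_def using equiv_ray_rel
  by (metis Image_singleton_iff equiv_class_eq quotientE)

lemma ray_interval_eq_range:
  assumes "Y1 \<in> rays scale" "Y2 \<in> rays scale" "e1 \<in> Y1" "e2 \<in> Y2"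
  shows "ray_interval scale Y1 Y2 = range (ray_param scale e1 e2)"
proof (intro equalityI subsetI)
  fix Z assume "Z \<in> ray_interval scale Y1 Y2"
  then obtain a c where Z: "Z = ray scale (scale a e1 + scale c e2)" "a \<noteq> 0 \<or> c \<noteq> 0"
    using ray_interval_eq[OF assms] by blast
  show "Z \<in> range (ray_param scale e1 e2)"
  proof (cases "a = 0")
    case True
    then have "Z = ray_param scale e1 e2 Infty"
      using Z by (simp add: ray_param_def scale_zero_left ray_scale)
    then show ?thesis by blast
  next
    case False
    have "a * (inverse a * c) = c"
      using False by (simp add: mult_inverse_nonzero flip: mult.assoc)
    then have "scale a e1 + scale c e2 = scale a (e1 + scale (inverse a * c) e2)"
      by (simp add: scale_add_right scale_scale)
    then have "Z = ray_param scale e1 e2 (Fin (inverse a * c))"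
      using Z False by (simp add: ray_param_def ray_scale)
    then show ?thesis by blast
  qed
next
  fix Z assume "Z \<in> range (ray_param scale e1 e2)"
  then obtain x where x: "Z = ray_param scale e1 e2 x" by blast
  have "\<exists>a c. Z = ray scale (scale a e1 + scale c e2) \<and> (a \<noteq> 0 \<or> c \<noteq> 0)"
  proof (cases x)
    case (Fin t)
    then have "Z = ray scale (scale 1 e1 + scale t e2)"
      using x by (simp add: ray_param_def scale_one)
    then show ?thesis using one_neq_zero by blast
  next
    case Infty
    then have "Z = ray scale (scale 0 e1 + scale 1 e2)"
      using x by (simp add: ray_param_def scale_one scale_zero_left)
    then show ?thesis using one_neq_zero by blast
  qed
  then show "Z \<in> ray_interval scale Y1 Y2" unfolding ray_interval_eq[OF assms] by blast
qed

text \<open>For \<open>\<alpha> \<noteq> 0\<close> write \<open>\<epsilon>\<^sub>1 + \<alpha>\<epsilon>\<^sub>2 = d\<epsilon>\<^sub>1\<close> and multiply by \<open>t = \<beta>/\<alpha> \<le> 1\<close> to get \<open>t\<epsilon>\<^sub>1 + \<beta>\<epsilon>\<^sub>2 = td\<epsilon>\<^sub>1\<close>. As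
  \<open>1 + t = 1\<close>, the summand \<open>t\<epsilon>\<^sub>1\<close> is absorbed when \<open>\<epsilon>\<^sub>1\<close> is added: \<open>\<epsilon>\<^sub>1 + \<beta>\<epsilon>\<^sub>2 = (1 + td)\<epsilon>\<^sub>1\<close>.\<close>

lemma ray_absorbs_smaller:
  assumes "e1 \<in> ray scale (e1 + scale \<alpha> e2)" and "\<beta> \<le> \<alpha>"
  shows "ray scale (e1 + scale \<beta> e2) = ray scale e1"
proof (cases "\<alpha> = 0")
  case True
  then have "\<beta> = 0" using assms(2) zero_le_semifield[of \<beta>] by simp
  then show ?thesis by (simp add: scale_zero_left)
next
  case False
  obtain a c where ac: "a \<noteq> 0" "scale a (e1 + scale \<alpha> e2) = scale c e1"
    using assms(1) unfolding ray_def ray_rel_def by blast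
  define d where "d = inverse a * c"
  have d: "e1 + scale \<alpha> e2 = scale d e1"
    using ac scale_inverse[of a "e1 + scale \<alpha> e2"] by (simp add: d_def scale_scale)
  define t where "t = inverse \<alpha> * \<beta>"
  have "t \<le> 1"
    using mult_left_mono_semifield[OF assms(2), of "inverse \<alpha>"] False
    by (simp add: t_def left_inverse_nonzero)
  then have absorb: "1 + t = 1" by (simp add: add_eq_max max_absorb1)
  have "t * \<alpha> = (inverse \<alpha> * \<alpha>) * \<beta>" by (simp add: t_def ac_simps)
  then have "t * \<alpha> = \<beta>" using False by (simp add: left_inverse_nonzero)
  then have scaled: "scale t e1 + scale \<beta> e2 = scale (t * d) e1"
    using arg_cong[OF d, of "scale t"] by (simp add: scale_add_right scale_scale)
  have "e1 + scale \<beta> e2 = scale (1 + t) e1 + scale \<beta> e2" by (simp add: absorb scale_one)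
  also have "\<dots> = e1 + (scale t e1 + scale \<beta> e2)"
    by (simp add: scale_add_left scale_one add.assoc)
  also have "\<dots> = scale (1 + t * d) e1" by (simp add: scaled scale_add_left scale_one)
  finally show ?thesis using ray_scale add_nonzero_left[of 1 "t * d"] by simp
qed

lemma ray_param_constant_below:
  assumes "Y1 \<in> rays scale" "Y2 \<in> rays scale" "Y1 \<noteq> Y2" "e1 \<in> Y1" "e2 \<in> Y2"
    and "ray_param scale e1 e2 x = Y1" and "y \<le> x"
  shows "ray_param scale e1 e2 y = Y1"
proof -
  obtain \<alpha> where \<alpha>: "x = Fin \<alpha>"
    using assms ray_eq_of_mem by (cases x) (auto simp: ray_param_def)
  then obtain \<beta> where \<beta>: "y = Fin \<beta>" "\<beta> \<le> \<alpha>"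
    using assms(7) by (cases y) (auto simp: less_eq_ext_def)
  have "e1 \<in> ray scale (e1 + scale \<alpha> e2)" using assms(4,6) \<alpha> by (simp add: ray_param_def)
  then show ?thesis
    using ray_absorbs_smaller[OF _ \<beta>(2)] ray_eq_of_mem assms(1,4) \<beta>(1)
    by (simp add: ray_param_def)
qed

text \<open>The mirror image of the preceding lemma: \<open>\<epsilon>\<^sub>1 + \<alpha>\<epsilon>\<^sub>2\<close> and \<open>\<epsilon>\<^sub>2 + \<alpha>\<^sup>-\<^sup>1\<epsilon>\<^sub>1\<close> span the same ray, and
  inversion reverses the order.\<close>

lemma ray_param_constant_above:
  assumes "Y1 \<in> rays scale" "Y2 \<in> rays scale" "Y1 \<noteq> Y2" "e1 \<in> Y1" "e2 \<in> Y2"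
    and "ray_param scale e1 e2 x = Y2" and "x \<le> y"
  shows "ray_param scale e1 e2 y = Y2"
proof (cases y)
  case Infty
  then show ?thesis using assms ray_eq_of_mem by (simp add: ray_param_def)
next
  case (Fin \<beta>)
  then obtain \<alpha> where \<alpha>: "x = Fin \<alpha>" "\<alpha> \<le> \<beta>"
    using assms(7) by (cases x) (auto simp: less_eq_ext_def)
  \<comment> \<open>at \<open>\<alpha> = 0\<close> the ray would be \<open>Y1\<close>\<close>
  have "\<alpha> \<noteq> 0"
    using assms \<alpha>(1) ray_eq_of_mem[of Y1 e1] by (auto simp: ray_param_def scale_zero_left)
  then have "\<beta> \<noteq> 0" using \<alpha>(2) zero_le_semifield[of \<alpha>] by auto
  have swap: "ray scale (e1 + scale c e2) = ray scale (e2 + scale (inverse c) e1)" if "c \<noteq> 0" for c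
  proof -
    have "e1 + scale c e2 = scale c (e2 + scale (inverse c) e1)"
      using that by (simp add: scale_add_right scale_scale mult_inverse_nonzero scale_one add.commute)
    then show ?thesis using that by (simp add: ray_scale)
  qed
  have "e2 \<in> ray scale (e2 + scale (inverse \<alpha>) e1)"
    using assms(5,6) \<alpha>(1) swap[OF \<open>\<alpha> \<noteq> 0\<close>] by (simp add: ray_param_def)
  moreover have "inverse \<beta> \<le> inverse \<alpha>"
    by (rule inverse_antimono_semifield[OF \<alpha>(2) \<open>\<alpha> \<noteq> 0\<close>])
  ultimately have "ray scale (e2 + scale (inverse \<beta>) e1) = ray scale e2"
    by (rule ray_absorbs_smaller)
  then show ?thesis
    using swap[OF \<open>\<beta> \<noteq> 0\<close>] Fin ray_eq_of_mem assms(2,5) by (simp add: ray_param_def)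
qed

text \<open>The rays between parameters representing \<open>Y1\<close> and \<open>Y2\<close> already exhaust the ray interval, even if
  these parameters are not \<open>0\<close> and \<open>\<infinity>\<close>.\<close>

lemma ray_param_image_between:
  assumes "Y1 \<in> rays scale" "Y2 \<in> rays scale" "Y1 \<noteq> Y2" "e1 \<in> Y1" "e2 \<in> Y2"
    and "ray_param scale e1 e2 x = Y1" and "ray_param scale e1 e2 y = Y2" and "x \<le> y"
  shows "ray_param scale e1 e2 ` {x..y} = range (ray_param scale e1 e2)"
proof
  show "range (ray_param scale e1 e2) \<subseteq> ray_param scale e1 e2 ` {x..y}"
  proof (clarify)
    fix z
    consider "z \<le> x" | "z \<in> {x..y}" | "y \<le> z" by force
    then show "ray_param scale e1 e2 z \<in> ray_param scale e1 e2 ` {x..y}"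
    proof cases
      case 1
      then have "ray_param scale e1 e2 z = ray_param scale e1 e2 x"
        using ray_param_constant_below[OF assms(1-6)] assms(6) by simp
      then show ?thesis using assms(8) by auto
    next
      case 3
      then have "ray_param scale e1 e2 z = ray_param scale e1 e2 y"
        using ray_param_constant_above[OF assms(1-5,7)] assms(7) by simp
      then show ?thesis using assms(8) by auto
    qed blast
  qed
qed blast

end


section \<open>Images and compositions of piecewise monomial functions on ray intervals\<close>

theorem theorem2p6:
  fixes scale :: "'r::root_closed_bipotent_semifield \<Rightarrow> 'v::comm_monoid_add \<Rightarrow> 'v"
    and q :: "'v \<Rightarrow> 'r" and b :: "'v \<Rightarrow> 'v \<Rightarrow> 'r"
    and Y1 Y2 :: "'v set" and e1 e2 :: 'v
    and F :: "'v set \<Rightarrow> 'r ext"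
  defines "\<pi> \<equiv> ray_param scale e1 e2"
  assumes "semifield_module scale"
    and "quadratic_form_with_companion scale q b" and "anisotropic q"
    and "Y1 \<in> rays scale" and "Y2 \<in> rays scale" and "Y1 \<noteq> Y2"
    and "e1 \<in> Y1" and "e2 \<in> Y2"
    and "piecewise_monomial_on_rays scale Y1 Y2 F"
  shows "\<exists>\<rho> \<sigma>. \<rho> \<le> \<sigma> \<and> F ` ray_interval scale Y1 Y2 = {\<rho>..\<sigma>} \<and>
    (\<forall>r \<alpha>. \<pi> (\<alpha> 0) = Y1 \<and> \<pi> (\<alpha> r) = Y2 \<and>
       (\<forall>s\<in>{1..r::nat}. \<alpha> (s - 1) < \<alpha> s \<and> monomial_on {\<alpha> (s - 1)..\<alpha> s} (F \<circ> \<pi>)) \<longrightarrow>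
       \<rho> = Min ((\<lambda>s. (F \<circ> \<pi>) (\<alpha> s)) ` {0..r}) \<and>
       \<sigma> = Max ((\<lambda>s. (F \<circ> \<pi>) (\<alpha> s)) ` {0..r})) \<and>
    (\<forall>u v \<phi>. {\<rho>..\<sigma>} \<subseteq> {u..v} \<and> piecewise_monomial_on u v \<phi> \<longrightarrow>
       piecewise_monomial_on_rays scale Y1 Y2 (\<phi> \<circ> F))"
proof -
  interpret semifield_module scale by fact
  note Y = \<open>Y1 \<in> rays scale\<close> \<open>Y2 \<in> rays scale\<close>
  note e = \<open>e1 \<in> Y1\<close> \<open>e2 \<in> Y2\<close>
  define f where "f = F \<circ> \<pi>"
  have image_F: "F ` ray_interval scale Y1 Y2 = range f"
    using ray_interval_eq_range[OF Y e] by (simp add: f_def \<pi>_def image_comp)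
  have pm: "piecewise_monomial_on (Fin 0) Infty f"
    using assms(10) piecewise_monomial_on_rays_iff[OF Y e] by (simp add: f_def \<pi>_def)
  then obtain n \<beta> where \<beta>: "\<beta> 0 = Fin 0" "\<beta> n = Infty"
      "\<And>s. s \<in> {1..n::nat} \<Longrightarrow> \<beta> (s - 1) < \<beta> s \<and> monomial_on {\<beta> (s - 1)..\<beta> s} f"
    by (auto simp: piecewise_monomial_on_def)
  define \<rho> where "\<rho> = Min ((\<lambda>s. f (\<beta> s)) ` {0..n})"
  define \<sigma> where "\<sigma> = Max ((\<lambda>s. f (\<beta> s)) ` {0..n})"
  have range_f: "range f = {\<rho>..\<sigma>}"
    using image_of_monomial_pieces[of n \<beta> f] \<beta> by (simp add: \<rho>_def \<sigma>_def ext_whole_interval)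
  have "{\<rho>..\<sigma>} \<noteq> {}" unfolding range_f[symmetric] by blast
  then have le: "\<rho> \<le> \<sigma>" by simp
  have extremes: "\<rho> = Min ((\<lambda>s. f (\<alpha> s)) ` {0..r}) \<and> \<sigma> = Max ((\<lambda>s. f (\<alpha> s)) ` {0..r})"
    if ends: "\<pi> (\<alpha> 0) = Y1" "\<pi> (\<alpha> r) = Y2"
      and pieces: "\<forall>s\<in>{1..r::nat}. \<alpha> (s - 1) < \<alpha> s \<and> monomial_on {\<alpha> (s - 1)..\<alpha> s} f"
    for r \<alpha>
  proof -
    have "\<alpha> 0 \<le> \<alpha> r" using breakpoints_mono[of r \<alpha>] pieces by auto
    then have "\<pi> ` {\<alpha> 0..\<alpha> r} = range \<pi>"
      using ray_param_image_between[OF Y \<open>Y1 \<noteq> Y2\<close> e] ends unfolding \<pi>_def by blast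
    then have "f ` {\<alpha> 0..\<alpha> r} = {\<rho>..\<sigma>}" using range_f by (metis f_def image_comp)
    \<comment> \<open>a nonempty closed interval determines its endpoints\<close>
    then show ?thesis
      using image_of_monomial_pieces[of r \<alpha> f] pieces le by (simp add: Icc_eq_Icc)
  qed
  have composition: "piecewise_monomial_on_rays scale Y1 Y2 (\<phi> \<circ> F)"
    if "{\<rho>..\<sigma>} \<subseteq> {u..v}" "piecewise_monomial_on u v \<phi>" for u v \<phi>
  proof -
    have "piecewise_monomial_on (Fin 0) Infty (\<phi> \<circ> f)"
      using piecewise_monomial_on_compose[OF pm that(2)] that(1) range_f
      by (simp add: ext_whole_interval)
    then show ?thesis
      using piecewise_monomial_on_rays_iff[OF Y e] by (simp add: f_def \<pi>_def comp_assoc)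
  qed
  show ?thesis
    unfolding f_def[symmetric]
  proof (rule exI[of _ \<rho>], rule exI[of _ \<sigma>], intro conjI allI impI)
    show "F ` ray_interval scale Y1 Y2 = {\<rho>..\<sigma>}" using image_F range_f by simp
  qed (use le extremes composition in auto)
qed

end
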